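(* Let $\mu$ be a probability measure on $\mathbb{R}$ whose support is not included in $(-\infty,0)$, and let $\mu^{*n}$ denote its $n$-fold convolution power. Consider the condition (E) there exists $\alpha>0$ such that $\mu^{*n}((-\infty,0))\le e^{-\alpha n}$ for infinitely many $n\ge1$. Whether (E) holds is determined by the restrictions of the measures $\mu^{*n}$, $n\ge1$, to $[0,\infty)$. Moreover, if (E) holds, then $\mu\in\mathscr{C}$, i.e. every probability measure $\mu_1$ on $\mathbb{R}$ such that $\mu_1^{*n}$ and $\mu^{*n}$ coincide on the Borel subsets of $[0,\infty)$ for all $n\ge1$ satisfies $\mu_1=\mu$.
   Context: $\mathscr{C}$ denotes the set of probability measures $\mu$ on $\mathbb{R}$ with the property: if $\mu_1$ is a probability measure on $\mathbb{R}$ with $\mu_1^{*n}=\mu^{*n}$ on $[0,\infty)$ for all $n\ge 1$, then $\mu_1=\mu$. Note $\mu^{*n}((-\infty,0))=\mathbb{P}(S_n<0)$ where $(S_n)$ is a random walk with $S_0=0$ and step distribution $\mu$. *)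

theory Defs
  imports "HOL-Probability.Probability" "HOL-Probability.Convolution"
begin

definition real_prob :: "real measure \<Rightarrow> bool" where
  "real_prob M \<longleftrightarrow> prob_space M \<and> sets M = sets borel"

fun conv_pow :: "real measure \<Rightarrow> nat \<Rightarrow> real measure" where
  "conv_pow M 0 = return borel 0"
| "conv_pow M (Suc n) = convolution (conv_pow M n) M"

definition msupport :: "real measure \<Rightarrow> real set" where
  "msupport M = {x. \<forall>e>0. emeasure M (ball x e) > 0}"

definition cond_E :: "real measure \<Rightarrow> bool" where
  "cond_E M \<longleftrightarrow> (\<exists>\<alpha>>0. infinite {n::nat. n \<ge> 1 \<and>
       measure (conv_pow M n) {..<0} \<le> exp (- \<alpha> * real n)})"

definition agree_nonneg :: "real measure \<Rightarrow> real measure \<Rightarrow> bool" where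
  "agree_nonneg M N \<longleftrightarrow> (\<forall>n\<ge>1. \<forall>A\<in>sets borel. A \<subseteq> {0..} \<longrightarrow>
       measure (conv_pow M n) A = measure (conv_pow N n) A)"

definition classC :: "real measure \<Rightarrow> bool" where
  "classC M \<longleftrightarrow> (\<forall>M1. real_prob M1 \<and> agree_nonneg M1 M \<longrightarrow> M1 = M)"

end

theory Submission
  imports Defs "HOL-Complex_Analysis.Conformal_Mappings"
begin

text \<open>
  Let \<open>M\<close> and \<open>N\<close> have convolution powers that agree on \<open>[0, \<infinity>)\<close>, and let \<open>\<phi>\<close> and \<open>\<psi>\<close> be their
  characteristic functions. The \<open>n\<close>-th powers then give the same mass to \<open>(-\<infinity>, 0)\<close>, and
  \<open>\<phi>^n - \<psi>^n\<close> is bounded by twice that mass. Under (E) this makes \<open>(\<phi>/\<psi>)^n\<close> uniformly close to 1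
  near the origin for infinitely many \<open>n\<close>. There \<open>\<phi>/\<psi>\<close> and \<open>exp (Ln ((\<phi>/\<psi>)^n) / n)\<close> are continuous
  \<open>n\<close>-th roots of the same zero-free function and agree at 0, so they are equal; letting \<open>n\<close> grow
  gives \<open>\<phi> = \<psi>\<close> near the origin. Since \<open>M - N\<close> lives on \<open>(-\<infinity>, 0)\<close>, the function \<open>\<phi> - \<psi>\<close> is the
  boundary value of a function holomorphic in a half-plane; vanishing on an interval of the boundary,
  it vanishes identically.
\<close>

section \<open>Integrals depending on a parameter\<close>

lemma set_lebesgue_integral_cong_measure:
  fixes f :: "'a \<Rightarrow> 'b::{banach, second_countable_topology}"
  assumes "sets P = sets Q" and "A \<in> sets P"
    and "\<And>B. B \<in> sets P \<Longrightarrow> B \<subseteq> A \<Longrightarrow> emeasure P B = emeasure Q B"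
  shows "set_lebesgue_integral P A f = set_lebesgue_integral Q A f"
proof -
  have "restrict_space P A = restrict_space Q A"
  proof (rule measure_eqI)
    show "sets (restrict_space P A) = sets (restrict_space Q A)"
      using \<open>sets P = sets Q\<close> by (rule sets_restrict_space_cong)
    fix B assume "B \<in> sets (restrict_space P A)"
    then have "B \<in> sets P" "B \<subseteq> A"
      using \<open>A \<in> sets P\<close> by (auto simp: sets_restrict_space_iff)
    then show "emeasure (restrict_space P A) B = emeasure (restrict_space Q A) B"
      using assms by (simp add: emeasure_restrict_space)
  qed
  moreover have "set_lebesgue_integral R A f = integral\<^sup>L (restrict_space R A) f"
    if "A \<in> sets R" for R
    using that by (simp add: set_lebesgue_integral_def integral_restrict_space)
  ultimately show ?thesis
    using assms(1,2) by simp
qed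

lemma tendsto_lebesgue_integral_at_within:
  fixes f :: "'a::first_countable_topology \<Rightarrow> 'b \<Rightarrow> 'c::{banach, second_countable_topology}"
  assumes measurable: "\<And>w. w \<in> S - {a} \<Longrightarrow> f w \<in> borel_measurable M"
    and lim: "\<And>x. x \<in> space M \<Longrightarrow> ((\<lambda>w. f w x) \<longlongrightarrow> g x) (at a within S)"
    and "integrable M h"
    and bound: "\<And>w x. w \<in> S - {a} \<Longrightarrow> x \<in> space M \<Longrightarrow> norm (f w x) \<le> h x"
  shows "((\<lambda>w. \<integral>x. f w x \<partial>M) \<longlongrightarrow> (\<integral>x. g x \<partial>M)) (at a within S)"
  unfolding tendsto_at_iff_sequentially comp_def
proof (intro allI impI)
  fix u assume u_in: "\<forall>n. u n \<in> S - {a}" and "u \<longlonglongrightarrow> a"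
  have lim_u: "(\<lambda>n. f (u n) x) \<longlonglongrightarrow> g x" if "x \<in> space M" for x
    using lim[OF that] u_in \<open>u \<longlonglongrightarrow> a\<close> unfolding tendsto_at_iff_sequentially comp_def by blast
  have measurable_u: "f (u n) \<in> borel_measurable M" for n
    using u_in by (intro measurable) blast
  show "(\<lambda>n. \<integral>x. f (u n) x \<partial>M) \<longlonglongrightarrow> (\<integral>x. g x \<partial>M)"
  proof (rule integral_dominated_convergence[OF _ measurable_u \<open>integrable M h\<close>])
    show "g \<in> borel_measurable M"
      using measurable_u lim_u by (rule borel_measurable_LIMSEQ_metric)
    show "AE x in M. (\<lambda>n. f (u n) x) \<longlonglongrightarrow> g x"
      using lim_u by (rule AE_I2)
    show "AE x in M. norm (f (u n) x) \<le> h x" for n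
      using u_in by (intro AE_I2 bound) auto
  qed
qed

lemma continuous_on_lebesgue_integral:
  fixes f :: "'a::first_countable_topology \<Rightarrow> 'b \<Rightarrow> 'c::{banach, second_countable_topology}"
  assumes measurable: "\<And>a. a \<in> S \<Longrightarrow> f a \<in> borel_measurable M"
    and cont: "\<And>x. x \<in> space M \<Longrightarrow> continuous_on S (\<lambda>a. f a x)"
    and "integrable M h" and bound: "\<And>a x. a \<in> S \<Longrightarrow> x \<in> space M \<Longrightarrow> norm (f a x) \<le> h x"
  shows "continuous_on S (\<lambda>a. \<integral>x. f a x \<partial>M)"
  unfolding continuous_on_def
proof
  fix a assume "a \<in> S"
  show "((\<lambda>a. \<integral>x. f a x \<partial>M) \<longlongrightarrow> (\<integral>x. f a x \<partial>M)) (at a within S)"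
  proof (rule tendsto_lebesgue_integral_at_within[OF _ _ \<open>integrable M h\<close>])
    show "((\<lambda>w. f w x) \<longlongrightarrow> f a x) (at a within S)" if "x \<in> space M" for x
      using cont[OF that] \<open>a \<in> S\<close> by (simp add: continuous_on_def)
  qed (use measurable bound in auto)
qed

lemma has_field_derivative_lebesgue_integral:
  fixes f :: "'a::{real_normed_field, banach, second_countable_topology} \<Rightarrow> 'b \<Rightarrow> 'a"
  assumes "open S" "convex S" "z \<in> S"
    and integrable_f: "\<And>w. w \<in> S \<Longrightarrow> integrable M (f w)"
    and deriv: "\<And>w x. w \<in> S \<Longrightarrow> x \<in> space M \<Longrightarrow> ((\<lambda>w. f w x) has_field_derivative f' w x) (at w)"
    and "integrable M h" and bound: "\<And>w x. w \<in> S \<Longrightarrow> x \<in> space M \<Longrightarrow> norm (f' w x) \<le> h x"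
  shows "((\<lambda>w. \<integral>x. f w x \<partial>M) has_field_derivative (\<integral>x. f' z x \<partial>M)) (at z)"
proof -
  define quot where "quot w x = (f w x - f z x) / (w - z)" for w x
  have "((\<lambda>w. \<integral>x. quot w x \<partial>M) \<longlongrightarrow> (\<integral>x. f' z x \<partial>M)) (at z within S)"
  proof (rule tendsto_lebesgue_integral_at_within[OF _ _ \<open>integrable M h\<close>])
    show "quot w \<in> borel_measurable M" if "w \<in> S - {z}" for w
      using that integrable_f[of w] integrable_f[OF \<open>z \<in> S\<close>] unfolding quot_def by auto
    show "((\<lambda>w. quot w x) \<longlongrightarrow> f' z x) (at z within S)" if "x \<in> space M" for x
      using has_field_derivative_at_within[OF deriv[OF \<open>z \<in> S\<close> that], of S]
      by (simp add: has_field_derivative_iff quot_def)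
    show "norm (quot w x) \<le> h x" if "w \<in> S - {z}" and "x \<in> space M" for w x
    proof -
      have "norm (f w x - f z x) \<le> h x * norm (w - z)"
        by (rule field_differentiable_bound[OF \<open>convex S\<close>,
              where f = "\<lambda>w. f w x" and f' = "\<lambda>w. f' w x"])
          (use that \<open>z \<in> S\<close> bound deriv in \<open>auto intro: has_field_derivative_at_within\<close>)
      then show ?thesis
        using that by (simp add: quot_def norm_divide divide_le_eq)
    qed
  qed
  moreover have "(\<integral>x. quot w x \<partial>M) = ((\<integral>x. f w x \<partial>M) - (\<integral>x. f z x \<partial>M)) / (w - z)" if "w \<in> S" for w
    using integrable_f[OF that] integrable_f[OF \<open>z \<in> S\<close>] by (simp add: quot_def)
  ultimately have "((\<lambda>w. ((\<integral>x. f w x \<partial>M) - (\<integral>x. f z x \<partial>M)) / (w - z)) \<longlongrightarrow> (\<integral>x. f' z x \<partial>M))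
      (at z within S)"
    by (simp cong: Lim_cong_within)
  then show ?thesis
    using \<open>open S\<close> \<open>z \<in> S\<close> by (simp add: has_field_derivative_iff at_within_open[of z S])
qed

lemma norm_deriv_le_Cauchy:
  assumes "f holomorphic_on S" "cball z r \<subseteq> S" "0 < r" and bound: "\<And>w. w \<in> S \<Longrightarrow> norm (f w) \<le> B"
  shows "norm (deriv f z) \<le> B / r"
proof -
  have "norm ((deriv ^^ 1) f z) \<le> fact 1 * B / r ^ 1"
  proof (rule Cauchy_inequality[OF _ _ \<open>0 < r\<close>])
    show "f holomorphic_on ball z r"
      using assms(1,2) by (meson ball_subset_cball holomorphic_on_subset)
    show "continuous_on (cball z r) f"
      using assms(1,2) by (meson holomorphic_on_imp_continuous_on continuous_on_subset)
    show "norm (f w) \<le> B" if "norm (z - w) = r" for w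
      using that assms(2) by (intro bound) (auto simp: dist_norm subset_iff)
  qed
  then show ?thesis by simp
qed

lemma holomorphic_on_lebesgue_integral:
  assumes "open S"
    and measurable: "\<And>z. z \<in> S \<Longrightarrow> f z \<in> borel_measurable M"
    and holo: "\<And>x. x \<in> space M \<Longrightarrow> (\<lambda>z. f z x) holomorphic_on S"
    and "integrable M h" and bound: "\<And>z x. z \<in> S \<Longrightarrow> x \<in> space M \<Longrightarrow> norm (f z x) \<le> h x"
  shows "(\<lambda>z. \<integral>x. f z x \<partial>M) holomorphic_on S"
  unfolding holomorphic_on_open[OF \<open>open S\<close>]
proof
  fix z assume "z \<in> S"
  then obtain e where "e > 0" and e_ball: "cball z e \<subseteq> S"
    using \<open>open S\<close> open_contains_cball by blast
  define r where "r = e / 2"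
  have "r > 0"
    using \<open>e > 0\<close> by (simp add: r_def)
  have subset: "cball w r \<subseteq> S" if "w \<in> ball z r" for w
  proof -
    have "cball w r \<subseteq> cball z e"
      using that by (simp add: r_def cball_subset_cball_iff dist_commute)
    then show ?thesis
      using e_ball by blast
  qed
  have in_S: "w \<in> S" if "w \<in> ball z r" for w
    using subset[OF that] \<open>r > 0\<close> by auto
  have "((\<lambda>z. \<integral>x. f z x \<partial>M) has_field_derivative (\<integral>x. deriv (\<lambda>z. f z x) z \<partial>M)) (at z)"
  proof (rule has_field_derivative_lebesgue_integral[where S = "ball z r" and h = "\<lambda>x. h x / r"])
    show "integrable M (f w)" if "w \<in> ball z r" for w
      using measurable[OF in_S[OF that]] order_trans[OF bound[OF in_S[OF that]] abs_ge_self]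
      by (intro Bochner_Integration.integrable_bound[OF \<open>integrable M h\<close>] AE_I2) auto
    show "((\<lambda>w. f w x) has_field_derivative deriv (\<lambda>z. f z x) w) (at w)"
      if "w \<in> ball z r" "x \<in> space M" for w x
      using holo[OF that(2)] \<open>open S\<close> in_S[OF that(1)] by (rule holomorphic_derivI)
    show "norm (deriv (\<lambda>z. f z x) w) \<le> h x / r" if "w \<in> ball z r" "x \<in> space M" for w x
      using holo[OF that(2)] subset[OF that(1)] \<open>r > 0\<close> bound[OF _ that(2)]
      by (rule norm_deriv_le_Cauchy)
  qed (use \<open>r > 0\<close> \<open>integrable M h\<close> in auto)
  then show "\<exists>D. ((\<lambda>z. \<integral>x. f z x \<partial>M) has_field_derivative D) (at z)" ..
qed

section \<open>Holomorphic functions vanishing on a boundary segment\<close>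

lemma holomorphic_on_extend_zero_across_line:
  assumes "open S" and "d \<noteq> 0"
    and holo: "f holomorphic_on S \<inter> {z. k < d \<bullet> z}"
    and cont: "continuous_on (S \<inter> {z. k \<le> d \<bullet> z}) f"
    and zero: "\<And>z. z \<in> S \<Longrightarrow> d \<bullet> z = k \<Longrightarrow> f z = 0"
  shows "(\<lambda>z. if k \<le> d \<bullet> z then f z else 0) holomorphic_on S"
proof (rule holomorphic_on_paste_across_line[OF \<open>open S\<close> \<open>d \<noteq> 0\<close>])
  let ?g = "\<lambda>z. if k \<le> d \<bullet> z then f z else 0"
  show "?g holomorphic_on S \<inter> {z. d \<bullet> z < k}"
    by (rule holomorphic_transform[where f = "\<lambda>_. 0"]) auto
  show "?g holomorphic_on S \<inter> {z. k < d \<bullet> z}"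
    using holo by (rule holomorphic_transform) auto
  have halves: "S = (S \<inter> {z. k \<le> d \<bullet> z}) \<union> (S \<inter> {z. d \<bullet> z \<le> k})"
    by auto
  have "closedin (top_of_set S) (S \<inter> {z. k \<le> d \<bullet> z})" "closedin (top_of_set S) (S \<inter> {z. d \<bullet> z \<le> k})"
    by (simp_all add: closedin_closed_Int closed_halfspace_ge closed_halfspace_le)
  then have "continuous_on ((S \<inter> {z. k \<le> d \<bullet> z}) \<union> (S \<inter> {z. d \<bullet> z \<le> k})) ?g"
    using cont zero by (intro continuous_on_cases_local) (auto simp flip: halves)
  then show "continuous_on S ?g"
    by (simp flip: halves)
qed

lemma holomorphic_eq_0_if_zero_on_line:
  assumes "open S" "connected S" and "d \<noteq> 0" and meets: "S \<inter> {z. d \<bullet> z < k} \<noteq> {}"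
    and holo: "f holomorphic_on S \<inter> {z. k < d \<bullet> z}"
    and cont: "continuous_on (S \<inter> {z. k \<le> d \<bullet> z}) f"
    and zero: "\<And>z. z \<in> S \<Longrightarrow> d \<bullet> z = k \<Longrightarrow> f z = 0"
    and "z \<in> S" "k \<le> d \<bullet> z"
  shows "f z = 0"
proof -
  define g where "g w = (if k \<le> d \<bullet> w then f w else 0)" for w
  have "g z = 0"
  proof (rule analytic_continuation_open[where f = g and s' = S and s = "S \<inter> {z. d \<bullet> z < k}"])
    show "open (S \<inter> {z. d \<bullet> z < k})"
      using \<open>open S\<close> open_halfspace_lt by (rule open_Int)
    show "g holomorphic_on S"
      unfolding g_def using \<open>open S\<close> \<open>d \<noteq> 0\<close> holo cont zero
      by (rule holomorphic_on_extend_zero_across_line)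
  qed (use assms(1,2) meets \<open>z \<in> S\<close> in \<open>auto simp: g_def\<close>)
  then show ?thesis
    using \<open>k \<le> d \<bullet> z\<close> by (simp add: g_def)
qed

lemma holomorphic_half_plane_eq_0_if_zero_on_segment:
  assumes "d \<noteq> 0"
    and holo: "f holomorphic_on {z. k < d \<bullet> z}" and cont: "continuous_on {z. k \<le> d \<bullet> z} f"
    and "d \<bullet> a = k" "0 < r" and zero: "\<And>z. z \<in> ball a r \<Longrightarrow> d \<bullet> z = k \<Longrightarrow> f z = 0"
    and "k \<le> d \<bullet> z"
  shows "f z = 0"
proof -
  define S where "S = ball a r \<union> {z. k < d \<bullet> z}"
  have "a \<in> ball a r \<inter> closure {z. k < d \<bullet> z}" "a \<in> ball a r \<inter> closure {z. d \<bullet> z < k}"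
    using \<open>d \<bullet> a = k\<close> \<open>0 < r\<close> \<open>d \<noteq> 0\<close> by simp_all
  then have meets: "ball a r \<inter> {z. k < d \<bullet> z} \<noteq> {}" "ball a r \<inter> {z. d \<bullet> z < k} \<noteq> {}"
    using open_Int_closure_eq_empty[OF open_ball, of a r] by blast+
  have "f w = 0" if "k < d \<bullet> w" for w
  proof (rule holomorphic_eq_0_if_zero_on_line[where f = f and S = S and d = d and k = k])
    show "open S"
      by (simp add: S_def open_Un open_halfspace_gt)
    show "connected S"
      unfolding S_def using meets(1) convex_ball convex_halfspace_gt
      by (intro connected_Un convex_connected)
    show "S \<inter> {z. d \<bullet> z < k} \<noteq> {}"
      using meets(2) by (auto simp: S_def)
    show "f holomorphic_on S \<inter> {z. k < d \<bullet> z}"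
      by (rule holomorphic_on_subset[OF holo]) auto
    show "continuous_on (S \<inter> {z. k \<le> d \<bullet> z}) f"
      by (rule continuous_on_subset[OF cont]) auto
    show "f z = 0" if "z \<in> S" "d \<bullet> z = k" for z
      using that zero by (auto simp: S_def)
  qed (use \<open>d \<noteq> 0\<close> that in \<open>auto simp: S_def\<close>)
  then show ?thesis
    using cont \<open>k \<le> d \<bullet> z\<close> \<open>d \<noteq> 0\<close> continuous_constant_on_closure[of "{z. k < d \<bullet> z}" f 0 z] by simp
qed

section \<open>Functions with close powers\<close>

lemma exp_Ln_power_div_eq_on_connected:
  fixes f :: "'a::topological_space \<Rightarrow> complex"
  assumes "connected S" "a \<in> S" and cont: "continuous_on S f" and "f a = 1" and "0 < n"
    and slit: "\<And>x. x \<in> S \<Longrightarrow> f x ^ n \<notin> \<real>\<^sub>\<le>\<^sub>0" and "x \<in> S"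
  shows "exp (Ln (f x ^ n) / of_nat n) = f x"
proof -
  define \<zeta> where "\<zeta> x = f x / exp (Ln (f x ^ n) / of_nat n)" for x
  have "\<zeta> x ^ n = 1" if "x \<in> S" for x
  proof -
    have "f x ^ n \<noteq> 0"
      using slit[OF that] by fastforce
    then show ?thesis
      using \<open>0 < n\<close> by (simp add: \<zeta>_def power_divide flip: exp_of_nat_mult)
  qed
  then have "\<zeta> ` S \<subseteq> {w. w ^ n = 1}"
    by auto
  then have "finite (\<zeta> ` S)"
    by (rule finite_subset) (use \<open>0 < n\<close> in \<open>simp add: finite_roots_unity\<close>)
  moreover have "continuous_on S \<zeta>"
    unfolding \<zeta>_def using slit \<open>0 < n\<close> by (intro continuous_intros cont) auto
  ultimately have "\<zeta> constant_on S"
    using \<open>connected S\<close> by (intro continuous_finite_range_constant)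
  then have "\<zeta> x = \<zeta> a"
    using \<open>x \<in> S\<close> \<open>a \<in> S\<close> by (auto simp: constant_on_def)
  also have "\<zeta> a = 1"
    by (simp add: \<zeta>_def \<open>f a = 1\<close>)
  finally show ?thesis
    by (simp add: \<zeta>_def)
qed

lemma eq_1_if_powers_near_1:
  fixes f :: "'a::topological_space \<Rightarrow> complex"
  assumes "connected S" "a \<in> S" "continuous_on S f" "f a = 1"
    and "infinite N" and near: "\<And>n x. n \<in> N \<Longrightarrow> x \<in> S \<Longrightarrow> norm (f x ^ n - 1) < 1 / 2"
    and "x \<in> S"
  shows "f x = 1"
proof -
  define n where "n k = enumerate N (Suc k)" for k
  have n_in: "n k \<in> N" and n_ge: "Suc k \<le> n k" for k
    unfolding n_def using \<open>infinite N\<close> by (rule enumerate_in_set, rule le_enumerate)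
  define w where "w k = Ln (f x ^ n k) / of_nat (n k)" for k
  have exp_w: "exp (w k) = f x" for k
    unfolding w_def
  proof (rule exp_Ln_power_div_eq_on_connected[OF assms(1-4) _ _ \<open>x \<in> S\<close>])
    show "f y ^ n k \<notin> \<real>\<^sub>\<le>\<^sub>0" if "y \<in> S" for y
      using near[OF n_in that, of k] abs_Re_le_cmod[of "f y ^ n k - 1"]
      by (auto simp: complex_nonpos_Reals_iff)
    show "0 < n k"
      using n_ge[of k] by simp
  qed
  have "norm (w k) \<le> inverse (real (Suc k))" for k
  proof -
    note near_x = near[OF n_in[of k] \<open>x \<in> S\<close>]
    have "norm (Ln (f x ^ n k)) \<le> 1"
      using norm_Ln_le[OF near_x] near_x by simp
    then have "norm (w k) \<le> 1 / real (n k)"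
      by (simp add: w_def norm_divide divide_right_mono)
    also have "\<dots> \<le> inverse (real (Suc k))"
      using n_ge[of k] by (simp add: field_simps)
    finally show ?thesis .
  qed
  then have "w \<longlonglongrightarrow> 0"
    by (intro Lim_null_comparison[OF _ LIMSEQ_inverse_real_of_nat] always_eventually allI)
  then have "(\<lambda>k. exp (w k)) \<longlonglongrightarrow> exp 0"
    by (rule tendsto_exp)
  then show ?thesis
    by (simp add: exp_w LIMSEQ_const_iff)
qed

lemma infinite_Collect_eventually_sequentially:
  assumes "infinite N" and "eventually P sequentially"
  shows "infinite {n \<in> N. P n}"
proof -
  have "frequently (\<lambda>n. n \<in> N) sequentially"
    using \<open>infinite N\<close> by (simp add: frequently_cofinite flip: cofinite_eq_sequentially)
  then have "frequently (\<lambda>n. P n \<and> n \<in> N) sequentially"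
    using assms(2) by (rule frequently_eventually_conj)
  then show ?thesis
    by (simp add: frequently_cofinite conj_commute flip: cofinite_eq_sequentially)
qed

lemma eq_if_powers_close:
  fixes f g :: "'a::topological_space \<Rightarrow> complex"
  assumes "connected S" "a \<in> S" and cont: "continuous_on S f" "continuous_on S g"
    and "f a = g a" and "0 \<le> c" "c < \<rho>" and lower: "\<And>x. x \<in> S \<Longrightarrow> \<rho> \<le> norm (g x)"
    and "infinite N" and close: "\<And>n x. n \<in> N \<Longrightarrow> x \<in> S \<Longrightarrow> norm (f x ^ n - g x ^ n) \<le> C * c ^ n"
    and "x \<in> S"
  shows "f x = g x"
proof -
  have g_nonzero: "g y \<noteq> 0" if "y \<in> S" for y
    using lower[OF that] \<open>0 \<le> c\<close> \<open>c < \<rho>\<close> by auto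
  define N' where "N' = {n \<in> N. C * (c / \<rho>) ^ n < 1 / 2}"
  have "(\<lambda>n. C * (c / \<rho>) ^ n) \<longlonglongrightarrow> C * 0"
    using \<open>0 \<le> c\<close> \<open>c < \<rho>\<close> by (intro tendsto_mult tendsto_const LIMSEQ_realpow_zero) auto
  then have "eventually (\<lambda>n. C * (c / \<rho>) ^ n < 1 / 2) sequentially"
    by (rule order_tendstoD) simp
  with \<open>infinite N\<close> have "infinite N'"
    unfolding N'_def by (rule infinite_Collect_eventually_sequentially)
  have near: "norm ((f y / g y) ^ n - 1) < 1 / 2" if "n \<in> N'" and "y \<in> S" for n y
  proof -
    have diff: "norm (f y ^ n - g y ^ n) \<le> C * c ^ n"
      using that close by (simp add: N'_def)
    have "norm ((f y / g y) ^ n - 1) = norm (f y ^ n - g y ^ n) / norm (g y) ^ n"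
      using g_nonzero[OF \<open>y \<in> S\<close>]
      by (simp add: power_divide diff_divide_distrib flip: norm_power norm_divide)
    also have "\<dots> \<le> C * c ^ n / \<rho> ^ n"
      using diff order_trans[OF norm_ge_zero diff] lower[OF \<open>y \<in> S\<close>] \<open>0 \<le> c\<close> \<open>c < \<rho>\<close>
      by (intro frac_le power_mono) auto
    also have "\<dots> < 1 / 2"
      using \<open>n \<in> N'\<close> by (simp add: N'_def power_divide)
    finally show ?thesis .
  qed
  have "f x / g x = 1"
  proof (rule eq_1_if_powers_near_1[OF assms(1,2) _ _ \<open>infinite N'\<close> near \<open>x \<in> S\<close>])
    show "continuous_on S (\<lambda>y. f y / g y)"
      using cont g_nonzero by (intro continuous_on_divide) auto
    show "f a / g a = 1"
      using g_nonzero[OF \<open>a \<in> S\<close>] \<open>f a = g a\<close> by simp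
  qed
  then show ?thesis
    using g_nonzero[OF \<open>x \<in> S\<close>] by simp
qed

section \<open>The Laplace transform of the negative part\<close>

text \<open>The sign of the exponent is chosen so that the integral converges for \<open>Re z \<ge> 0\<close>.\<close>
definition laplace_neg :: "real measure \<Rightarrow> complex \<Rightarrow> complex" where
  "laplace_neg M z = (LINT x:{..<0}|M. exp (z * of_real x))"

lemma norm_indicator_lessThan_exp_le:
  assumes "0 \<le> Re z"
  shows "norm (indicator {..<0} x *\<^sub>R exp (z * of_real x)) \<le> indicator {..<0} x"
  using assms by (auto split: split_indicator simp: mult_nonneg_nonpos)

context finite_borel_measure
begin

declare M_is_borel [measurable_cong]

lemma integrable_indicator_neg: "integrable M (indicator {..<0} :: real \<Rightarrow> real)"
  using emeasure_finite by (intro integrable_real_indicator) (auto simp: less_top[symmetric])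

lemma norm_laplace_neg_le:
  assumes "0 \<le> Re z"
  shows "norm (laplace_neg M z) \<le> measure M {..<0}"
proof -
  have "norm (laplace_neg M z) \<le> (\<integral>x. indicator {..<0} x \<partial>M)"
    unfolding laplace_neg_def set_lebesgue_integral_def
    using integrable_indicator_neg norm_indicator_lessThan_exp_le[OF assms]
    by (intro Bochner_Integration.integral_norm_bound_integral
        Bochner_Integration.integrable_bound[OF integrable_indicator_neg] AE_I2) auto
  also have "\<dots> = measure M {..<0}"
    by (simp add: sets_eq_imp_space_eq[OF M_is_borel])
  finally show ?thesis .
qed

lemma continuous_on_laplace_neg: "continuous_on {z. 0 \<le> Re z} (laplace_neg M)"
  unfolding laplace_neg_def set_lebesgue_integral_def
proof (rule continuous_on_lebesgue_integral[OF _ _ integrable_indicator_neg])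
  show "norm (indicator {..<0} x *\<^sub>R exp (z * of_real x)) \<le> indicator {..<0} x"
    if "z \<in> {z. 0 \<le> Re z}" for z :: complex and x :: real
    using that by (intro norm_indicator_lessThan_exp_le) simp
  show "continuous_on {z. 0 \<le> Re z} (\<lambda>z. indicator {..<0} x *\<^sub>R exp (z * of_real x))" for x :: real
    by (intro continuous_intros)
qed auto

lemma holomorphic_on_laplace_neg: "laplace_neg M holomorphic_on {z. 0 < Re z}"
  unfolding laplace_neg_def set_lebesgue_integral_def
proof (rule holomorphic_on_lebesgue_integral[OF open_halfspace_Re_gt _ _ integrable_indicator_neg])
  show "(\<lambda>z. indicator {..<0} x *\<^sub>R exp (z * of_real x)) holomorphic_on {z. 0 < Re z}" for x :: real
    unfolding scaleR_conv_of_real by (intro holomorphic_intros)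
  show "norm (indicator {..<0} x *\<^sub>R exp (z * of_real x)) \<le> indicator {..<0} x"
    if "z \<in> {z. 0 < Re z}" for z :: complex and x :: real
    using that by (intro norm_indicator_lessThan_exp_le) simp
qed auto

lemma char_eq_nonneg_plus_laplace_neg:
  "char M t = (LINT x:{0..}|M. iexp (t * x)) + laplace_neg M (\<i> * of_real t)"
proof -
  have "integrable M (\<lambda>x. iexp (t * x))"
    by (rule integrable_const_bound[where B = 1]) auto
  then have "set_integrable M A (\<lambda>x. iexp (t * x))" if "A \<in> sets borel" for A
    unfolding set_integrable_def using that by (intro integrable_mult_indicator) auto
  then have "(LINT x:{0..} \<union> {..<0}|M. iexp (t * x)) =
      (LINT x:{0..}|M. iexp (t * x)) + (LINT x:{..<0}|M. iexp (t * x))"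
    by (intro set_integral_Un) auto
  moreover have "{0..} \<union> {..<0} = (UNIV :: real set)"
    by auto
  ultimately show ?thesis
    by (simp add: char_def laplace_neg_def set_lebesgue_integral_def mult.assoc)
qed

end

lemma char_diff_eq_laplace_neg_diff:
  assumes "finite_borel_measure P" "finite_borel_measure Q"
    and agree: "\<And>A. A \<in> sets borel \<Longrightarrow> A \<subseteq> {0..} \<Longrightarrow> measure P A = measure Q A"
  shows "char P t - char Q t = laplace_neg P (\<i> * of_real t) - laplace_neg Q (\<i> * of_real t)"
proof -
  interpret P: finite_borel_measure P by fact
  interpret Q: finite_borel_measure Q by fact
  have "(LINT x:{0..}|P. iexp (t * x)) = (LINT x:{0..}|Q. iexp (t * x))"
    by (rule set_lebesgue_integral_cong_measure)
      (auto simp: P.M_is_borel Q.M_is_borel P.emeasure_eq_measure Q.emeasure_eq_measure agree)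
  then show ?thesis
    by (simp add: P.char_eq_nonneg_plus_laplace_neg Q.char_eq_nonneg_plus_laplace_neg)
qed

section \<open>Convolution powers\<close>

lemma real_prob_iff_real_distribution: "real_prob M \<longleftrightarrow> real_distribution M"
  by (simp add: real_prob_def real_distribution_def real_distribution_axioms_def)

lemma real_distribution_convolution:
  assumes "real_distribution M" "real_distribution N"
  shows "real_distribution (M \<star> N)"
proof -
  interpret M: real_distribution M by fact
  interpret N: real_distribution N by fact
  interpret pair_prob_space M N ..
  show ?thesis
    unfolding convolution_def by (rule P.real_distribution_distr) measurable
qed

lemma char_convolution:
  assumes "real_distribution M" "real_distribution N"
  shows "char (M \<star> N) t = char M t * char N t"
proof -
  interpret M: real_distribution M by fact
  interpret N: real_distribution N by fact
  interpret pair_prob_space M N ..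
  have integrable: "integrable (M \<Otimes>\<^sub>M N) (\<lambda>(x, y). iexp (t * (x + y)))"
    by (rule P.integrable_const_bound[where B = 1]) (auto split: prod.split)
  have "char (M \<star> N) t = (CLINT p|(M \<Otimes>\<^sub>M N). (\<lambda>(x, y). iexp (t * (x + y))) p)"
    unfolding char_def convolution_def by (subst integral_distr) (auto simp: case_prod_unfold)
  also have "\<dots> = (CLINT x|M. CLINT y|N. iexp (t * (x + y)))"
    using integral_fst'[OF integrable] by simp
  also have "\<dots> = (CLINT x|M. CLINT y|N. iexp (t * x) * iexp (t * y))"
    by (simp add: distrib_left exp_add)
  also have "\<dots> = char M t * char N t"
    by (simp add: char_def)
  finally show ?thesis .
qed

context real_distribution
begin

lemma prob_lessThan: "prob {..<a} = 1 - prob {a..}"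
proof -
  have "{..<a} = space M - {a..}"
    by auto
  then show ?thesis
    using prob_compl[of "{a..}"] by simp
qed

lemma real_distribution_conv_pow: "real_distribution (conv_pow M n)"
proof (induction n)
  case 0
  show ?case
    by (simp add: real_distribution_def real_distribution_axioms_def prob_space_return)
next
  case (Suc n)
  then show ?case
    by (simp add: real_distribution_convolution real_distribution_axioms)
qed

lemma char_conv_pow: "char (conv_pow M n) t = char M t ^ n"
proof (induction n)
  case 0
  show ?case
    by (simp add: char_def integral_return)
next
  case (Suc n)
  then show ?case
    by (simp add: char_convolution real_distribution_conv_pow real_distribution_axioms)
qed

lemma conv_pow_1: "conv_pow M 1 = M"
  using char_conv_pow[of 1]
  by (intro Levy_uniqueness real_distribution_conv_pow real_distribution_axioms) auto

end

section \<open>Distributions whose convolution powers agree on the nonnegative half-line\<close>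

locale agree_nonneg_distributions = M: real_distribution M + N: real_distribution N for M N +
  assumes agree_nonneg: "agree_nonneg M N"
begin

lemma measure_conv_pow_neg_eq:
  assumes "1 \<le> n"
  shows "measure (conv_pow M n) {..<0} = measure (conv_pow N n) {..<0}"
  using assms agree_nonneg
  by (simp add: agree_nonneg_def real_distribution.prob_lessThan
      M.real_distribution_conv_pow N.real_distribution_conv_pow)

lemma cond_E_iff: "cond_E M \<longleftrightarrow> cond_E N"
proof -
  have "{n. n \<ge> 1 \<and> measure (conv_pow M n) {..<0} \<le> exp (- \<alpha> * real n)} =
      {n. n \<ge> 1 \<and> measure (conv_pow N n) {..<0} \<le> exp (- \<alpha> * real n)}" for \<alpha>
    using measure_conv_pow_neg_eq by auto
  then show ?thesis
    by (simp add: cond_E_def)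
qed

lemma char_power_diff_eq:
  assumes "1 \<le> n"
  shows "char M t ^ n - char N t ^ n =
    laplace_neg (conv_pow M n) (\<i> * of_real t) - laplace_neg (conv_pow N n) (\<i> * of_real t)"
proof -
  interpret Mn: real_distribution "conv_pow M n" by (rule M.real_distribution_conv_pow)
  interpret Nn: real_distribution "conv_pow N n" by (rule N.real_distribution_conv_pow)
  have "measure (conv_pow M n) A = measure (conv_pow N n) A" if "A \<in> sets borel" "A \<subseteq> {0..}" for A
    using assms agree_nonneg that by (simp add: agree_nonneg_def)
  then have "char (conv_pow M n) t - char (conv_pow N n) t =
      laplace_neg (conv_pow M n) (\<i> * of_real t) - laplace_neg (conv_pow N n) (\<i> * of_real t)"
    by (rule char_diff_eq_laplace_neg_diff[OF Mn.finite_borel_measure_M Nn.finite_borel_measure_M])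
  then show ?thesis
    by (simp add: M.char_conv_pow N.char_conv_pow)
qed

lemma norm_char_power_diff_le:
  assumes "1 \<le> n"
  shows "norm (char M t ^ n - char N t ^ n) \<le> 2 * measure (conv_pow N n) {..<0}"
proof -
  interpret Mn: real_distribution "conv_pow M n" by (rule M.real_distribution_conv_pow)
  interpret Nn: real_distribution "conv_pow N n" by (rule N.real_distribution_conv_pow)
  have "norm (char M t ^ n - char N t ^ n) \<le>
      norm (laplace_neg (conv_pow M n) (\<i> * of_real t)) +
      norm (laplace_neg (conv_pow N n) (\<i> * of_real t))"
    unfolding char_power_diff_eq[OF assms] by (rule norm_triangle_ineq4)
  also have "\<dots> \<le> measure (conv_pow M n) {..<0} + measure (conv_pow N n) {..<0}"
    by (intro add_mono Mn.norm_laplace_neg_le Nn.norm_laplace_neg_le) auto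
  finally show ?thesis
    using measure_conv_pow_neg_eq[OF assms] by simp
qed

lemma cond_E_imp_char_eq_near_0:
  assumes "cond_E N"
  obtains r where "0 < r" "\<And>t. t \<in> ball 0 r \<Longrightarrow> char M t = char N t"
proof -
  obtain \<alpha> where "\<alpha> > 0"
    and infinite_decay:
      "infinite {n. n \<ge> 1 \<and> measure (conv_pow N n) {..<0} \<le> exp (- \<alpha> * real n)}" (is "infinite ?A")
    using assms by (auto simp: cond_E_def)
  have "((\<lambda>t. norm (char N t)) \<longlongrightarrow> norm (char N 0)) (nhds 0)"
    using N.isCont_char[of 0]
    by (intro tendsto_norm) (simp add: isCont_def tendsto_at_iff_tendsto_nhds)
  then have "eventually (\<lambda>t. exp (- \<alpha> / 2) < norm (char N t)) (nhds 0)"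
    by (rule order_tendstoD) (use \<open>\<alpha> > 0\<close> in \<open>simp add: N.char_zero\<close>)
  then obtain r where "0 < r" and lower: "\<And>t. t \<in> ball 0 r \<Longrightarrow> exp (- \<alpha> / 2) < norm (char N t)"
    unfolding eventually_nhds_metric by (auto simp: dist_commute)
  have "char M t = char N t" if "t \<in> ball 0 r" for t
  proof (rule eq_if_powers_close[OF _ _ _ _ _ _ _ _ infinite_decay _ that,
        where f = "char M" and g = "char N" and a = 0
          and c = "exp (- \<alpha>)" and \<rho> = "exp (- \<alpha> / 2)" and C = 2])
    show "norm (char M s ^ n - char N s ^ n) \<le> 2 * exp (- \<alpha>) ^ n" if "n \<in> ?A" for n s
      using norm_char_power_diff_le[of n s] that by (simp add: mult.commute flip: exp_of_nat_mult)
    show "exp (- \<alpha> / 2) \<le> norm (char N s)" if "s \<in> ball 0 r" for s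
      using lower[OF that] by simp
  qed (use \<open>\<alpha> > 0\<close> \<open>0 < r\<close> in \<open>auto simp: M.char_zero N.char_zero
      intro!: continuous_at_imp_continuous_on M.isCont_char N.isCont_char\<close>)
  then show thesis
    using \<open>0 < r\<close> that by blast
qed

lemma char_eq_if_eq_near_0:
  assumes "0 < r" and near: "\<And>t. t \<in> ball 0 r \<Longrightarrow> char M t = char N t"
  shows "char M t = char N t"
proof -
  define f where "f z = laplace_neg M z - laplace_neg N z" for z
  have f_axis: "f (\<i> * of_real s) = char M s - char N s" for s
    using char_power_diff_eq[of 1 s] unfolding f_def M.conv_pow_1 N.conv_pow_1 by simp
  have "f (\<i> * of_real t) = 0"
  proof (rule holomorphic_half_plane_eq_0_if_zero_on_segment[
        where f = f and d = 1 and k = 0 and a = 0 and r = r])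
    show "f holomorphic_on {z. 0 < 1 \<bullet> z}"
      unfolding f_def using M.holomorphic_on_laplace_neg N.holomorphic_on_laplace_neg
      by (intro holomorphic_on_diff) (simp_all add: inner_complex_def)
    show "continuous_on {z. 0 \<le> 1 \<bullet> z} f"
      unfolding f_def using M.continuous_on_laplace_neg N.continuous_on_laplace_neg
      by (intro continuous_on_diff) (simp_all add: inner_complex_def)
    show "f z = 0" if "z \<in> ball 0 r" "1 \<bullet> z = 0" for z
    proof -
      have "z = \<i> * of_real (Im z)"
        using that(2) by (simp add: complex_eq_iff inner_complex_def)
      moreover have "Im z \<in> ball 0 r"
        using that(1) abs_Im_le_cmod[of z] by simp
      ultimately show ?thesis
        using f_axis[of "Im z"] near by simp
    qed
  qed (use \<open>0 < r\<close> in \<open>auto simp: inner_complex_def\<close>)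
  then show ?thesis
    by (simp add: f_axis)
qed

lemma cond_E_imp_eq:
  assumes "cond_E N"
  shows "M = N"
proof (rule Levy_uniqueness[OF M.real_distribution_axioms N.real_distribution_axioms], rule ext)
  fix t
  obtain r where "0 < r" "\<And>t. t \<in> ball 0 r \<Longrightarrow> char M t = char N t"
    using cond_E_imp_char_eq_near_0[OF assms] by blast
  then show "char M t = char N t"
    by (rule char_eq_if_eq_near_0)
qed

end

theorem theorem2p4:
  fixes \<mu> :: "real measure"
  assumes "real_prob \<mu>"
    and "\<not> msupport \<mu> \<subseteq> {..<0}"
  shows "(\<forall>\<mu>1. real_prob \<mu>1 \<and> agree_nonneg \<mu>1 \<mu> \<longrightarrow> (cond_E \<mu>1 \<longleftrightarrow> cond_E \<mu>)) \<and>
         (cond_E \<mu> \<longrightarrow> classC \<mu>)"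
proof -
  have "agree_nonneg_distributions \<mu>1 \<mu>" if "real_prob \<mu>1 \<and> agree_nonneg \<mu>1 \<mu>" for \<mu>1
    using that assms(1)
    by (simp add: agree_nonneg_distributions_def agree_nonneg_distributions_axioms_def
        real_prob_iff_real_distribution)
  then show ?thesis
    using agree_nonneg_distributions.cond_E_iff agree_nonneg_distributions.cond_E_imp_eq
    unfolding classC_def by blast
qed

end
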